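(* Let $(A,D(A))$ be a closed and densely defined operator on a complex Banach space $X$. Then $$\sigma_n(A)=\overline{co}\{\langle Ax,j(x)\rangle:\ x\in D(A),\ \|x\|=1,\ j(x)\in\mathfrak{J}(x)\}\ \cup\ \sigma_r(A),$$ where the right-hand side is the union of the closed convex hull of the displayed set with $\sigma_r(A)$.
   Context: For $\theta\in[0,2\pi)$ and $\omega\in\mathbb{R}$ let $H_{\theta,\omega}:=\{e^{i\theta}\lambda:\ \lambda\in\mathbb{C},\ \mathrm{Re}\,\lambda>\omega\}$, an open half plane with boundary $\partial H_{\theta,\omega}$, and let $d(\lambda,\partial H_{\theta,\omega}):=\inf\{|\lambda-\mu|:\mu\in\partial H_{\theta,\omega}\}$. For a closed, densely defined operator $(A,D(A))$ with resolvent set $\rho(A)$ and resolvent $R(\lambda,A)=(\lambda-A)^{-1}$, the numerical resolvent set $\rho_n(A)$ is the union of all open half planes $H_{\theta,\omega}$ (with $\theta\in[0,2\pi)$, $\omega\in\mathbb{R}$) such that $H_{\theta,\omega}\subseteq\rho(A)$ and $\|R(\lambda,A)\|\le \frac{1}{d(\lambda,\partial H_{\theta,\omega})}$ for all $\lambda\in H_{\theta,\omega}$. The numerical spectrum is $\sigma_n(A):=\mathbb{C}\setminus\rho_n(A)$. For $x\in X$ the duality set is $\mathfrak{J}(x):=\{j(x)\in X':\ \langle x,j(x)\rangle=\|x\|^2=\|j(x)\|^2\}$, where $X'$ is the dual of $X$ and $\langle\cdot,\cdot\rangle$ is the duality pairing. $\overline{co}\,M$ denotes the closure of the convex hull of $M\subseteq\mathbb{C}$.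 The residual spectrum is $\sigma_r(A):=\{\lambda\in\mathbb{C}:\ \text{the range of }\lambda-A\text{ is not dense in }X\}$. *)

theory Defs
  imports "HOL-Analysis.Analysis"
begin

text \<open>Complex Banach spaces are a type class on top of the real ones; the real structure is the
  restriction of the complex one to real scalars.\<close>

class complex_vector = real_vector +
  fixes scaleC :: "complex \<Rightarrow> 'a \<Rightarrow> 'a"  (infixr \<open>*\<^sub>C\<close> 75)
  assumes scaleC_add_right: "c *\<^sub>C (x + y) = c *\<^sub>C x + c *\<^sub>C y"
    and scaleC_add_left: "(b + c) *\<^sub>C x = b *\<^sub>C x + c *\<^sub>C x"
    and scaleC_scaleC: "b *\<^sub>C (c *\<^sub>C x) = (b * c) *\<^sub>C x"
    and scaleC_one: "1 *\<^sub>C x = x"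
    and scaleR_scaleC: "r *\<^sub>R x = complex_of_real r *\<^sub>C x"

class complex_normed_vector = complex_vector + real_normed_vector +
  assumes norm_scaleC: "norm (c *\<^sub>C x) = cmod c * norm x"

class complex_banach = complex_normed_vector + complete_space

subclass (in complex_banach) banach ..

instantiation complex :: complex_banach
begin

definition scaleC_complex :: "complex \<Rightarrow> complex \<Rightarrow> complex" where
  [simp]: "scaleC_complex c z = c * z"

instance
  by standard (auto simp: algebra_simps scaleR_conv_of_real norm_mult)

end

global_interpretation complex_vector: vector_space "scaleC :: complex \<Rightarrow> 'a \<Rightarrow> 'a::complex_vector"
  defines csubspace = complex_vector.subspace
  by standard (simp_all add: scaleC_add_right scaleC_add_left scaleC_scaleC scaleC_one)

definition bounded_clinear :: "('a::complex_normed_vector \<Rightarrow> 'b::complex_normed_vector) \<Rightarrow> bool" where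
  "bounded_clinear f \<longleftrightarrow> bounded_linear f \<and> (\<forall>c x. f (c *\<^sub>C x) = c *\<^sub>C f x)"

text \<open>A linear operator with domain \<open>D\<close> is a total function \<open>A\<close> together with \<open>D\<close>; every notion
  below depends only on the values of \<open>A\<close> on \<open>D\<close>.\<close>

definition linear_operator :: "('a::complex_vector \<Rightarrow> 'a) \<Rightarrow> 'a set \<Rightarrow> bool" where
  "linear_operator A D \<longleftrightarrow> csubspace D
     \<and> (\<forall>x\<in>D. \<forall>y\<in>D. A (x + y) = A x + A y)
     \<and> (\<forall>c. \<forall>x\<in>D. A (c *\<^sub>C x) = c *\<^sub>C A x)"

definition closed_operator :: "('a::complex_normed_vector \<Rightarrow> 'a) \<Rightarrow> 'a set \<Rightarrow> bool" where
  "closed_operator A D \<longleftrightarrow> linear_operator A D \<and> closed {(x, A x) | x. x \<in> D}"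

definition densely_defined :: "'a::complex_normed_vector set \<Rightarrow> bool" where
  "densely_defined D \<longleftrightarrow> closure D = UNIV"

definition resolvent :: "('a::complex_vector \<Rightarrow> 'a) \<Rightarrow> 'a set \<Rightarrow> complex \<Rightarrow> 'a \<Rightarrow> 'a" where
  "resolvent A D z = inv_into D (\<lambda>x. z *\<^sub>C x - A x)"

definition resolvent_set :: "('a::complex_normed_vector \<Rightarrow> 'a) \<Rightarrow> 'a set \<Rightarrow> complex set" where
  "resolvent_set A D =
     {z. bij_betw (\<lambda>x. z *\<^sub>C x - A x) D UNIV \<and> bounded_clinear (resolvent A D z)}"

definition residual_spectrum :: "('a::complex_normed_vector \<Rightarrow> 'a) \<Rightarrow> 'a set \<Rightarrow> complex set" where
  "residual_spectrum A D = {z. closure ((\<lambda>x. z *\<^sub>C x - A x) ` D) \<noteq> UNIV}"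

definition half_plane :: "real \<Rightarrow> real \<Rightarrow> complex set" where
  "half_plane \<theta> \<omega> = {cis \<theta> * z | z. Re z > \<omega>}"

definition numerical_resolvent_set ::
    "('a::complex_normed_vector \<Rightarrow> 'a) \<Rightarrow> 'a set \<Rightarrow> complex set" where
  "numerical_resolvent_set A D =
     \<Union>{half_plane \<theta> \<omega> | \<theta> \<omega>. 0 \<le> \<theta> \<and> \<theta> < 2 * pi
        \<and> half_plane \<theta> \<omega> \<subseteq> resolvent_set A D
        \<and> (\<forall>z\<in>half_plane \<theta> \<omega>.
              onorm (resolvent A D z) \<le> 1 / infdist z (frontier (half_plane \<theta> \<omega>)))}"

definition numerical_spectrum ::
    "('a::complex_normed_vector \<Rightarrow> 'a) \<Rightarrow> 'a set \<Rightarrow> complex set" where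
  "numerical_spectrum A D = UNIV - numerical_resolvent_set A D"

definition duality_set :: "'a::complex_normed_vector \<Rightarrow> ('a \<Rightarrow> complex) set" where
  "duality_set x = {j. bounded_clinear j
     \<and> j x = complex_of_real ((norm x)\<^sup>2) \<and> (norm x)\<^sup>2 = (onorm j)\<^sup>2}"

end

theory Submission
  imports Defs
begin

text \<open>Write \<open>d z = inner (cis \<theta>) z - \<omega>\<close> for the distance from a point \<open>z\<close> of a half plane to its
  boundary. By \<open>resolvent_set_iff\<close> a half plane contributes to the numerical resolvent set
  exactly if, throughout it, \<open>z - A\<close> maps \<open>D\<close> onto the space and satisfies the lower bound
  \<open>d z * norm x \<le> norm (z *\<^sub>C x - A x)\<close>. Everything is expressed through this condition,
  and the theorem says that such a half plane containing \<open>z\<close> exists exactly if \<open>z\<close> lies neither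
  in the closed convex hull of the numerical range nor in the residual spectrum.

  Suppose that \<open>z\<close> lies in neither. Then a half plane containing \<open>z\<close> is disjoint from the
  numerical range (\<open>half_plane_separation\<close>). Testing \<open>v x - A x\<close> with a functional from the duality
  set of \<open>x\<close> gives the lower bound on the whole half plane (\<open>bounded_below_off_numerical_range\<close>);
  that the duality set has an element is the Hahn-Banach theorem (\<open>duality_set_nonempty\<close>). As
  \<open>A\<close> is closed, the lower bound makes the range of \<open>z - A\<close> closed, and it is dense because \<open>z\<close> is
  not in the residual spectrum, so \<open>z - A\<close> is onto (\<open>dense_range_imp_surj\<close>). Surjectivity then
  spreads from \<open>z\<close> over the connected half plane (\<open>surj_on_half_plane\<close>).

  Conversely, in a half plane with the condition, \<open>z - A\<close> is onto, so \<open>z\<close> is not in the residual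
  spectrum. The rotated and shifted operator \<open>B = cis (- \<theta>) A - \<omega>\<close> satisfies the
  resolvent bound \<open>1 / t\<close> at every \<open>t > 0\<close>, which for a densely defined operator forces
  \<open>Re (j (B x)) \<le> 0\<close> for every \<open>j\<close> in the duality set of \<open>x\<close>
  (\<open>Lumer_Phillips_dissipative\<close>). Hence the numerical range, and with it its closed convex
  hull, lies in the complementary closed half plane.\<close>

section \<open>Norming functionals\<close>

text \<open>Homogeneity is demanded only as an inequality: applied to \<open>c\<close> and to \<open>1 / c\<close> it gives the
  equation (\<open>sublinear_scaleR\<close>), and it is quicker to verify for infima.\<close>
definition sublinear :: "('a::real_vector \<Rightarrow> real) \<Rightarrow> bool" where
  "sublinear p \<longleftrightarrow> (\<forall>x y. p (x + y) \<le> p x + p y) \<and> (\<forall>c\<ge>0. \<forall>x. p (c *\<^sub>R x) \<le> c * p x)"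

lemma sublinear_add: "sublinear p \<Longrightarrow> p (x + y) \<le> p x + p y"
  by (simp add: sublinear_def)

lemma sublinear_scaleR_le: "sublinear p \<Longrightarrow> 0 \<le> c \<Longrightarrow> p (c *\<^sub>R x) \<le> c * p x"
  by (simp add: sublinear_def)

lemma sublinear_zero: "sublinear p \<Longrightarrow> p 0 = 0"
  using sublinear_add[of p 0 0] sublinear_scaleR_le[of p 0 0] by simp

lemma sublinear_scaleR:
  assumes "sublinear p" "0 \<le> c" shows "p (c *\<^sub>R x) = c * p x"
proof (cases "c = 0")
  case True
  then show ?thesis using sublinear_zero[OF assms(1)] by simp
next
  case False
  then have "c > 0" using assms by simp
  have "p x = p ((1/c) *\<^sub>R (c *\<^sub>R x))" using \<open>c > 0\<close> by simp
  also have "\<dots> \<le> (1/c) * p (c *\<^sub>R x)"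
    using \<open>c > 0\<close> by (intro sublinear_scaleR_le[OF assms(1)]) simp
  finally have "c * p x \<le> p (c *\<^sub>R x)" using \<open>c > 0\<close> by (simp add: field_simps)
  then show ?thesis using sublinear_scaleR_le[OF assms, of x] by simp
qed

lemma sublinear_minus_le: "sublinear p \<Longrightarrow> - p (- x) \<le> p x"
  using sublinear_add[of p x "- x"] sublinear_zero[of p] by simp

lemma sublinear_norm: "sublinear (norm :: 'a::real_normed_vector \<Rightarrow> real)"
  by (simp add: sublinear_def norm_triangle_ineq)

text \<open>The largest sublinear functional \<open>q \<le> p\<close> with \<open>q (- z) \<le> - p z\<close>, that is, one for which the
  inequality \<open>- q (- z) \<le> p z\<close> becomes an equation. It carries the whole Hahn-Banach argument:
  it prescribes a value at \<open>z\<close>, and a minimal sublinear functional is a fixed point of it for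
  every \<open>z\<close>, which forces additivity.\<close>
definition flatten :: "('a::real_vector \<Rightarrow> real) \<Rightarrow> 'a \<Rightarrow> 'a \<Rightarrow> real" where
  "flatten p z y = (INF t\<in>{0..}. p (y + t *\<^sub>R z) - t * p z)"

lemma flatten_le:
  assumes "sublinear p" "0 \<le> t"
  shows "flatten p z y \<le> p (y + t *\<^sub>R z) - t * p z"
proof -
  have "- p (- y) \<le> p (y + s *\<^sub>R z) - s * p z" if "s \<ge> 0" for s
    using sublinear_add[OF assms(1), of "- y" "y + s *\<^sub>R z"] sublinear_scaleR[OF assms(1) that, of z]
    by simp
  then have "bdd_below ((\<lambda>t. p (y + t *\<^sub>R z) - t * p z) ` {0..})"
    by (intro bdd_belowI2[of _ "- p (- y)"]) auto
  then show ?thesis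
    unfolding flatten_def using assms(2) by (intro cINF_lower) auto
qed

lemma flatten_greatest:
  "(\<And>t. 0 \<le> t \<Longrightarrow> m \<le> p (y + t *\<^sub>R z) - t * p z) \<Longrightarrow> m \<le> flatten p z y"
  unfolding flatten_def by (intro cINF_greatest) auto

lemma flatten_le_self: "sublinear p \<Longrightarrow> flatten p z y \<le> p y"
  using flatten_le[of p 0 z y] by simp

lemma sublinear_flatten:
  assumes p: "sublinear p" shows "sublinear (flatten p z)"
  unfolding sublinear_def
proof (intro conjI allI impI)
  fix x y
  have "flatten p z (x + y) - (p (y + t *\<^sub>R z) - t * p z) \<le> flatten p z x" if "t \<ge> 0" for t
  proof (rule flatten_greatest)
    fix s :: real assume "0 \<le> s"
    have "flatten p z (x + y) \<le> p ((x + y) + (s + t) *\<^sub>R z) - (s + t) * p z"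
      using \<open>0 \<le> s\<close> that by (intro flatten_le[OF p]) simp
    also have "p ((x + y) + (s + t) *\<^sub>R z) \<le> p (x + s *\<^sub>R z) + p (y + t *\<^sub>R z)"
      using sublinear_add[OF p, of "x + s *\<^sub>R z" "y + t *\<^sub>R z"] by (simp add: algebra_simps)
    finally show "flatten p z (x + y) - (p (y + t *\<^sub>R z) - t * p z) \<le> p (x + s *\<^sub>R z) - s * p z"
      by (simp add: algebra_simps)
  qed
  then have "flatten p z (x + y) - flatten p z x \<le> flatten p z y"
    by (intro flatten_greatest) (simp add: algebra_simps)
  then show "flatten p z (x + y) \<le> flatten p z x + flatten p z y" by simp
next
  fix c :: real and x assume "0 \<le> c"
  show "flatten p z (c *\<^sub>R x) \<le> c * flatten p z x"
  proof (cases "c = 0")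
    case True
    then show ?thesis using flatten_le_self[OF p, of z 0] sublinear_zero[OF p] by simp
  next
    case False
    with \<open>0 \<le> c\<close> have "c > 0" by simp
    have "flatten p z (c *\<^sub>R x) / c \<le> flatten p z x"
    proof (rule flatten_greatest)
      fix t :: real assume "0 \<le> t"
      have "flatten p z (c *\<^sub>R x) \<le> p (c *\<^sub>R x + (c * t) *\<^sub>R z) - (c * t) * p z"
        using \<open>c > 0\<close> \<open>0 \<le> t\<close> by (intro flatten_le[OF p]) simp
      also have "p (c *\<^sub>R x + (c * t) *\<^sub>R z) = c * p (x + t *\<^sub>R z)"
        using sublinear_scaleR[OF p \<open>0 \<le> c\<close>, of "x + t *\<^sub>R z"] by (simp add: algebra_simps)
      finally show "flatten p z (c *\<^sub>R x) / c \<le> p (x + t *\<^sub>R z) - t * p z"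
        using \<open>c > 0\<close> by (simp add: field_simps)
    qed
    then show ?thesis using \<open>c > 0\<close> by (simp add: field_simps)
  qed
qed

text \<open>Zorn's lemma for the reverse pointwise order. The infimum of a chain exists because every
  sublinear \<open>q \<le> p\<close> satisfies \<open>- p (- x) \<le> - q (- x) \<le> q x\<close>.\<close>
lemma minimal_sublinear_exists:
  fixes p :: "'a::real_vector \<Rightarrow> real"
  assumes p: "sublinear p"
  obtains m where "sublinear m" "m \<le> p" "\<And>q. sublinear q \<Longrightarrow> q \<le> m \<Longrightarrow> q = m"
proof -
  define M where "M = {q. sublinear q \<and> q \<le> p}"
  have "\<exists>m\<in>M. \<forall>q\<in>M. (\<ge>) m q \<longrightarrow> q = m"
  proof (rule predicate_Zorn)
    show "partial_order_on M (relation_of (\<ge>) M)"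
      by (rule partial_order_on_relation_ofI) auto
    fix C assume C: "C \<in> Chains (relation_of (\<ge>) M)"
    then have CM: "C \<subseteq> M" by (rule Chains_relation_of)
    have total: "q \<le> r \<or> r \<le> q" if "q \<in> C" "r \<in> C" for q r
      using C that by (auto simp: Chains_def relation_of_def)
    show "\<exists>u\<in>M. \<forall>q\<in>C. q \<ge> u"
    proof (cases "C = {}")
      case True
      have "p \<in> M" using p by (simp add: M_def)
      with True show ?thesis by auto
    next
      case False
      define u where "u = (\<lambda>x. INF q\<in>C. q x)"
      have sub: "sublinear q" "q \<le> p" if "q \<in> C" for q
        using that CM by (auto simp: M_def)
      have lower: "- p (- x) \<le> q x" if "q \<in> C" for q x
        using sublinear_minus_le[OF sub(1)[OF that], of x] le_funD[OF sub(2)[OF that], of "- x"]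
        by linarith
      have u_le: "u x \<le> q x" if "q \<in> C" for q x
        unfolding u_def using that lower by (intro cINF_lower bdd_belowI2[of _ "- p (- x)"]) auto
      have u_greatest: "b \<le> u x" if "\<And>q. q \<in> C \<Longrightarrow> b \<le> q x" for b x
        unfolding u_def using that False by (intro cINF_greatest) auto
      have "sublinear u"
        unfolding sublinear_def
      proof (intro conjI allI impI)
        fix x y
        have "u (x + y) - r y \<le> q x" if qr: "q \<in> C" "r \<in> C" for q r
        proof -
          \<comment> \<open>In a chain the smaller of two members serves both summands.\<close>
          obtain s where s: "s \<in> C" "s \<le> q" "s \<le> r" using total[OF qr] qr by blast
          have "u (x + y) \<le> s x + s y"
            using u_le[OF s(1)] sublinear_add[OF sub(1)[OF s(1)]] order_trans by blast
          also have "\<dots> \<le> q x + r y" using s by (intro add_mono) (auto simp: le_fun_def)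
          finally show ?thesis by simp
        qed
        then have "u (x + y) - r y \<le> u x" if "r \<in> C" for r
          using that by (intro u_greatest) auto
        then have "u (x + y) - u x \<le> u y" by (intro u_greatest) (auto simp: algebra_simps)
        then show "u (x + y) \<le> u x + u y" by simp
      next
        fix c :: real and x assume "0 \<le> c"
        show "u (c *\<^sub>R x) \<le> c * u x"
        proof (cases "c = 0")
          case True
          obtain q where "q \<in> C" using False by blast
          then show ?thesis using u_le[of q 0] sub(1) sublinear_zero True by force
        next
          case False
          with \<open>0 \<le> c\<close> have "c > 0" by simp
          have "u (c *\<^sub>R x) / c \<le> u x"
          proof (rule u_greatest)
            fix q assume "q \<in> C"
            then have "u (c *\<^sub>R x) \<le> c * q x"
              using u_le sublinear_scaleR_le[OF sub(1) \<open>0 \<le> c\<close>] order_trans by blast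
            then show "u (c *\<^sub>R x) / c \<le> q x" using \<open>c > 0\<close> by (simp add: field_simps)
          qed
          then show ?thesis using \<open>c > 0\<close> by (simp add: field_simps)
        qed
      qed
      moreover have "u \<le> p"
      proof -
        obtain q where "q \<in> C" using False by blast
        then show ?thesis using u_le sub(2) by (intro order_trans[of u q p]) (auto simp: le_fun_def)
      qed
      ultimately have "u \<in> M" by (simp add: M_def)
      then show ?thesis using u_le by (auto simp: le_fun_def)
    qed
  qed
  then obtain m where "m \<in> M" and min: "\<And>q. q \<in> M \<Longrightarrow> q \<le> m \<Longrightarrow> q = m" by blast
  show thesis
  proof (rule that[of m])
    show "sublinear m" "m \<le> p" using \<open>m \<in> M\<close> by (auto simp: M_def)
    show "q = m" if "sublinear q" "q \<le> m" for q
      using that \<open>m \<le> p\<close> by (intro min) (auto simp: M_def)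
  qed
qed

text \<open>By minimality flattening in any direction \<open>z\<close> changes nothing; the term \<open>t = 1\<close> of the infimum
  then is the superadditivity \<open>m y + m z \<le> m (y + z)\<close>.\<close>
lemma minimal_sublinear_linear:
  assumes m: "sublinear m" and min: "\<And>q. sublinear q \<Longrightarrow> q \<le> m \<Longrightarrow> q = m"
  shows "linear m"
proof -
  have "flatten m z = m" for z
    using m by (intro min sublinear_flatten) (auto simp: le_fun_def flatten_le_self)
  then have "m y \<le> m (y + z) - m z" for y z
    using flatten_le[OF m, of 1 z y] by simp
  then have add: "m (y + z) = m y + m z" for y z
    using sublinear_add[OF m, of y z] by (smt (verit))
  have neg: "m (- y) = - m y" for y
    using add[of y "- y"] sublinear_zero[OF m] by simp
  have "m (c *\<^sub>R y) = c * m y" for c y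
  proof (cases "c \<ge> 0")
    case True then show ?thesis by (rule sublinear_scaleR[OF m])
  next
    case False
    then have "m ((- c) *\<^sub>R y) = (- c) * m y" by (intro sublinear_scaleR[OF m]) simp
    then show ?thesis using neg[of "c *\<^sub>R y"] by simp
  qed
  then show ?thesis using add by (intro linearI) auto
qed

text \<open>Hahn-Banach without extension from a subspace: any linear functional below the norm
  flattened along \<open>x\<close> takes the value \<open>norm x\<close> at \<open>x\<close>.\<close>
lemma norming_functional_real:
  fixes x :: "'a::real_normed_vector"
  obtains f :: "'a \<Rightarrow> real" where "linear f" "\<And>y. f y \<le> norm y" "f x = norm x"
proof -
  have "sublinear (flatten norm x)" by (rule sublinear_flatten[OF sublinear_norm])
  then obtain f where f: "sublinear f" "f \<le> flatten norm x"
    and "\<And>q. sublinear q \<Longrightarrow> q \<le> f \<Longrightarrow> q = f"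
    using minimal_sublinear_exists by blast
  then have lin: "linear f" by (intro minimal_sublinear_linear) auto
  have le: "f y \<le> norm y" for y
    using f(2) flatten_le_self[OF sublinear_norm, of x y] by (auto simp: le_fun_def intro: order_trans)
  have "f (- x) \<le> - norm x"
    using f(2) flatten_le[OF sublinear_norm, of 1 x "- x"] by (auto simp: le_fun_def intro: order_trans)
  then have "f x \<ge> norm x" using linear_neg[OF lin, of x] by simp
  with le[of x] have "f x = norm x" by simp
  with lin le show thesis by (rule that)
qed

lemma cmod_le_onorm:
  assumes "bounded_clinear j" shows "cmod (j y) \<le> onorm j * norm y"
  using assms onorm unfolding bounded_clinear_def by blast

text \<open>The complex functional whose real part is the norming functional \<open>f\<close> is
  \<open>j y = f y - \<i> f (\<i> y)\<close>. Its norm is no larger than that of \<open>f\<close>, and then \<open>Re (j x) = 1\<close> leaves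
  no room for an imaginary part of \<open>j x\<close>.\<close>
lemma duality_set_nonempty:
  fixes x :: "'a::complex_normed_vector"
  assumes x: "norm x = 1"
  obtains j where "j \<in> duality_set x"
proof -
  obtain f :: "'a \<Rightarrow> real" where lin: "linear f" and le: "\<And>y. f y \<le> norm y" and fx: "f x = norm x"
    using norming_functional_real by blast
  define j where "j y = Complex (f y) (- f (\<i> *\<^sub>C y))" for y
  have i_add: "\<i> *\<^sub>C (u + v) = \<i> *\<^sub>C u + \<i> *\<^sub>C v" for u v :: 'a
    by (rule scaleC_add_right)
  have i_real: "\<i> *\<^sub>C (r *\<^sub>R u) = r *\<^sub>R (\<i> *\<^sub>C u)" for r and u :: 'a
    by (simp add: scaleR_scaleC scaleC_scaleC mult.commute)
  have ii: "\<i> *\<^sub>C (\<i> *\<^sub>C u) = - u" for u :: 'a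
    by (simp add: scaleC_scaleC)
  have add: "j (u + v) = j u + j v" for u v
    by (simp add: j_def complex_eq_iff i_add linear_add[OF lin])
  have real: "j (r *\<^sub>R u) = r *\<^sub>R j u" for r u
    by (simp add: j_def complex_eq_iff i_real linear_scale[OF lin])
  have imag: "j (\<i> *\<^sub>C u) = \<i> * j u" for u
    by (simp add: j_def complex_eq_iff ii linear_neg[OF lin])
  have hom: "j (c *\<^sub>C u) = c * j u" for c u
  proof -
    have "c *\<^sub>C u = (complex_of_real (Re c) + complex_of_real (Im c) * \<i>) *\<^sub>C u"
      by (simp add: complex_eq mult.commute)
    also have "\<dots> = Re c *\<^sub>R u + Im c *\<^sub>R (\<i> *\<^sub>C u)"
      by (simp add: scaleC_add_left scaleR_scaleC scaleC_scaleC)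
    finally have "j (c *\<^sub>C u) = Re c *\<^sub>R j u + Im c *\<^sub>R (\<i> * j u)"
      by (simp add: add real imag)
    then show ?thesis by (simp add: complex_eq_iff)
  qed
  have bound: "cmod (j y) \<le> norm y" for y
  proof (cases "j y = 0")
    case False
    \<comment> \<open>Rotate \<open>y\<close> so that its value becomes real, where \<open>j\<close> agrees with \<open>f\<close>.\<close>
    define c where "c = cnj (j y) / complex_of_real (cmod (j y))"
    have "cmod c = 1" using False by (simp add: c_def norm_divide)
    have "j (c *\<^sub>C y) = complex_of_real (cmod (j y))"
      using False complex_norm_square[of "j y"]
      by (simp add: hom c_def divide_simps power2_eq_square mult.commute)
    then have "cmod (j y) = f (c *\<^sub>C y)" by (simp add: j_def complex_eq_iff)
    also have "\<dots> \<le> norm (c *\<^sub>C y)" by (rule le)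
    also have "\<dots> = norm y" using \<open>cmod c = 1\<close> by (simp add: norm_scaleC)
    finally show ?thesis .
  qed simp
  have bl: "bounded_linear j"
    by (rule bounded_linear_intro[where K = 1]) (use add real bound in auto)
  then have bc: "bounded_clinear j" using hom by (simp add: bounded_clinear_def)
  have "Re (j x) = 1" using fx x by (simp add: j_def)
  moreover have "(cmod (j x))\<^sup>2 \<le> 1" using bound[of x] x by (simp add: power_le_one)
  ultimately have jx: "j x = 1" by (simp add: cmod_power2 complex_eq_iff)
  have "onorm j \<le> 1" using bound by (intro onorm_bound) auto
  moreover have "1 \<le> onorm j" using cmod_le_onorm[OF bc, of x] x jx by simp
  ultimately have "onorm j = 1" by simp
  then have "j \<in> duality_set x" using bc jx x by (simp add: duality_set_def)
  then show thesis by (rule that)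
qed

section \<open>Half planes\<close>

lemma half_plane_eq: "half_plane \<theta> \<omega> = {z. inner (cis \<theta>) z > \<omega>}"
proof (intro set_eqI iffI)
  have inner_cis: "inner (cis \<theta>) v = Re (cis (- \<theta>) * v)" for v
    by (simp add: inner_complex_def)
  fix z
  show "z \<in> {z. inner (cis \<theta>) z > \<omega>}" if "z \<in> half_plane \<theta> \<omega>"
  proof -
    obtain w where "z = cis \<theta> * w" "Re w > \<omega>" using \<open>z \<in> half_plane \<theta> \<omega>\<close> by (auto simp: half_plane_def)
    moreover from this have "cis (- \<theta>) * z = w" by (simp only: mult.assoc[symmetric] cis_mult) simp
    ultimately show ?thesis by (simp only: inner_cis mem_Collect_eq)
  qed
  show "z \<in> half_plane \<theta> \<omega>" if "z \<in> {z. inner (cis \<theta>) z > \<omega>}"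
  proof -
    have "z = cis \<theta> * (cis (- \<theta>) * z)" by (simp only: mult.assoc[symmetric] cis_mult) simp
    moreover have "Re (cis (- \<theta>) * z) > \<omega>" using that by (simp only: inner_cis mem_Collect_eq)
    ultimately show ?thesis unfolding half_plane_def by blast
  qed
qed

lemma infdist_frontier_half_plane:
  assumes "z \<in> half_plane \<theta> \<omega>"
  shows "infdist z (frontier (half_plane \<theta> \<omega>)) = inner (cis \<theta>) z - \<omega>"
proof -
  let ?L = "{w. inner (cis \<theta>) w = \<omega>}" and ?d = "inner (cis \<theta>) z - \<omega>"
  have fr: "frontier (half_plane \<theta> \<omega>) = ?L"
    unfolding half_plane_eq by (rule frontier_halfspace_gt) simp
  have d: "?d > 0" using assms by (simp add: half_plane_eq)
  have unit: "inner (cis \<theta>) (cis \<theta>) = 1" by (simp add: dot_square_norm)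
  \<comment> \<open>the foot of the perpendicular from \<open>z\<close>\<close>
  define w where "w = z - ?d *\<^sub>R cis \<theta>"
  have w: "w \<in> ?L" unfolding w_def using unit by (simp add: inner_diff_right)
  have "infdist z ?L \<le> dist z w" using w by (rule infdist_le)
  also have "\<dots> = ?d" using d by (simp add: w_def dist_norm)
  finally have "infdist z ?L \<le> ?d" .
  moreover have "?d \<le> infdist z ?L"
  proof -
    have "?d \<le> dist z v" if "v \<in> ?L" for v
      using that norm_cauchy_schwarz[of "cis \<theta>" "z - v"]
      by (simp add: inner_diff_right dist_norm)
    then show ?thesis using w by (auto simp: infdist_def intro!: cINF_greatest)
  qed
  ultimately show ?thesis using fr by simp
qed

text \<open>A separating line, normalised so that its normal vector is \<open>cis \<theta>\<close> with \<open>\<theta>\<close> in the prescribed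
  range. The empty set needs its own case since the separating functional may then be zero; it
  occurs when the underlying space is trivial.\<close>
lemma half_plane_separation:
  fixes S :: "complex set"
  assumes "convex S" "closed S" "z \<notin> S"
  obtains \<theta> \<omega> where "0 \<le> \<theta>" "\<theta> < 2 * pi" "z \<in> half_plane \<theta> \<omega>" "S \<inter> half_plane \<theta> \<omega> = {}"
proof (cases "S = {}")
  case True
  then show thesis using that[of 0 "Re z - 1"] by (simp add: half_plane_eq inner_complex_def)
next
  case False
  obtain a b where ab: "inner a z < b" "\<And>s. s \<in> S \<Longrightarrow> b < inner a s"
    using separating_hyperplane_closed_point[OF assms] by blast
  have "a \<noteq> 0" using ab False by fastforce
  define \<theta> where "\<theta> = Arg2pi (- a)"
  have "- a = cmod a *\<^sub>R cis \<theta>"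
    using Arg2pi_eq[of "- a"] by (simp add: \<theta>_def cis_conv_exp scaleR_conv_of_real)
  then have inn: "inner a v = - (cmod a * inner (cis \<theta>) v)" for v
    by (metis inner_minus_left inner_scaleR_left minus_minus)
  show thesis
  proof (rule that[of \<theta> "- b / cmod a"])
    show "0 \<le> \<theta>" "\<theta> < 2 * pi" by (auto simp: \<theta>_def Arg2pi_ge_0 Arg2pi_lt_2pi)
    show "z \<in> half_plane \<theta> (- b / cmod a)"
      using ab(1) \<open>a \<noteq> 0\<close> by (simp add: half_plane_eq inn field_simps)
    show "S \<inter> half_plane \<theta> (- b / cmod a) = {}"
      using ab(2) \<open>a \<noteq> 0\<close> by (fastforce simp: half_plane_eq inn field_simps)
  qed
qed

section \<open>Operators bounded below\<close>

lemma linear_operatorD: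
  assumes "linear_operator A D"
  shows "0 \<in> D"
    and "x \<in> D \<Longrightarrow> y \<in> D \<Longrightarrow> x + y \<in> D"
    and "x \<in> D \<Longrightarrow> c *\<^sub>C x \<in> D"
    and "x \<in> D \<Longrightarrow> y \<in> D \<Longrightarrow> A (x + y) = A x + A y"
    and "x \<in> D \<Longrightarrow> A (c *\<^sub>C x) = c *\<^sub>C A x"
    and "x \<in> D \<Longrightarrow> y \<in> D \<Longrightarrow> x - y \<in> D"
    and "x \<in> D \<Longrightarrow> y \<in> D \<Longrightarrow> A (x - y) = A x - A y"
proof -
  have sub: "csubspace D" using assms by (simp add: linear_operator_def)
  show add: "x \<in> D \<Longrightarrow> y \<in> D \<Longrightarrow> A (x + y) = A x + A y" for x y
    using assms by (simp add: linear_operator_def)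
  show scale: "x \<in> D \<Longrightarrow> A (c *\<^sub>C x) = c *\<^sub>C A x" for x c
    using assms by (simp add: linear_operator_def)
  show "0 \<in> D" "x \<in> D \<Longrightarrow> y \<in> D \<Longrightarrow> x + y \<in> D" "x \<in> D \<Longrightarrow> c *\<^sub>C x \<in> D"
    using sub by (auto simp: complex_vector.subspace_def)
  show diff: "x - y \<in> D" if "x \<in> D" "y \<in> D" for x y
    using sub that by (rule complex_vector.subspace_diff)
  show "A (x - y) = A x - A y" if "x \<in> D" "y \<in> D" for x y
    using add[OF diff[OF that] that(2)] by (simp add: algebra_simps)
qed

lemma bounded_linear_scaleC: "bounded_linear (\<lambda>x::'a::complex_normed_vector. c *\<^sub>C x)"
  by (rule bounded_linear_intro[where K = "cmod c"])
     (auto simp: scaleC_add_right scaleR_scaleC scaleC_scaleC norm_scaleC mult.commute)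

text \<open>Trades the inverse and its operator norm for surjectivity and a lower bound, conditions on
  \<open>A\<close> itself. The lower bound contains injectivity because \<open>d > 0\<close>.\<close>
lemma resolvent_set_iff:
  fixes A :: "'a::complex_normed_vector \<Rightarrow> 'a"
  assumes lin: "linear_operator A D" and "d > 0"
  shows "z \<in> resolvent_set A D \<and> onorm (resolvent A D z) \<le> 1 / d \<longleftrightarrow>
    (\<lambda>x. z *\<^sub>C x - A x) ` D = UNIV \<and> (\<forall>x\<in>D. d * norm x \<le> norm (z *\<^sub>C x - A x))"
    (is "?L \<longleftrightarrow> ?R")
proof
  assume ?L
  then have bij: "bij_betw (\<lambda>x. z *\<^sub>C x - A x) D UNIV"
    and bl: "bounded_linear (resolvent A D z)" and on: "onorm (resolvent A D z) \<le> 1 / d"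
    by (auto simp: resolvent_set_def bounded_clinear_def)
  have "d * norm x \<le> norm (z *\<^sub>C x - A x)" if "x \<in> D" for x
  proof -
    have "resolvent A D z (z *\<^sub>C x - A x) = x"
      unfolding resolvent_def
      using inv_into_f_f[OF bij_betw_imp_inj_on[OF bij] that] by simp
    then have "norm x \<le> onorm (resolvent A D z) * norm (z *\<^sub>C x - A x)"
      using onorm[OF bl, of "z *\<^sub>C x - A x"] by simp
    also have "\<dots> \<le> 1 / d * norm (z *\<^sub>C x - A x)" using on by (intro mult_right_mono) auto
    finally show ?thesis using \<open>d > 0\<close> by (simp add: field_simps)
  qed
  then show ?R using bij by (auto simp: bij_betw_def)
next
  assume R: ?R
  let ?T = "\<lambda>x. z *\<^sub>C x - A x" and ?R = "resolvent A D z"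
  note L = linear_operatorD[OF lin]
  have T_add: "?T (x + y) = ?T x + ?T y" if "x \<in> D" "y \<in> D" for x y
    using that by (simp add: L scaleC_add_right)
  have T_diff: "?T (x - y) = ?T x - ?T y" if "x \<in> D" "y \<in> D" for x y
    using that by (simp add: L complex_vector.scale_right_diff_distrib)
  have T_scale: "?T (c *\<^sub>C x) = c *\<^sub>C ?T x" if "x \<in> D" for x c
    using that by (simp add: L complex_vector.scale_right_diff_distrib scaleC_scaleC mult.commute)
  have inj: "inj_on ?T D"
  proof (rule inj_onI)
    fix x y assume xy: "x \<in> D" "y \<in> D" "?T x = ?T y"
    have "d * norm (x - y) \<le> norm (?T (x - y))" using R L(6)[OF xy(1,2)] by blast
    also have "\<dots> = 0" using T_diff[OF xy(1,2)] xy(3) by simp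
    finally show "x = y" using \<open>d > 0\<close> by (simp add: mult_le_0_iff)
  qed
  have inD: "?R y \<in> D" and TR: "?T (?R y) = y" for y
    using R inv_into_into[of y ?T D] f_inv_into_f[of y ?T D] by (auto simp: resolvent_def)
  have RT: "?R (?T x) = x" if "x \<in> D" for x
    unfolding resolvent_def using inv_into_f_f[OF inj that] by simp
  have bound: "norm (?R y) \<le> norm y * (1 / d)" for y
  proof -
    have "d * norm (?R y) \<le> norm (?T (?R y))" using R inD by blast
    then show ?thesis using TR \<open>d > 0\<close> by (simp add: field_simps)
  qed
  have add: "?R (x + y) = ?R x + ?R y" for x y
  proof -
    have "x + y = ?T (?R x + ?R y)" using T_add[OF inD inD, of x y] TR by simp
    then show ?thesis using RT[OF L(2)[OF inD inD], of x y] by simp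
  qed
  have scale: "?R (c *\<^sub>C x) = c *\<^sub>C ?R x" for c x
  proof -
    have "c *\<^sub>C x = ?T (c *\<^sub>C ?R x)" using T_scale[OF inD, of c x] TR by simp
    then show ?thesis using RT[OF L(3)[OF inD], of c x] by simp
  qed
  have "bounded_linear ?R"
    by (rule bounded_linear_intro[OF _ _ bound]) (auto simp: add scale scaleR_scaleC)
  moreover have "onorm ?R \<le> 1 / d"
    using bound \<open>d > 0\<close> by (intro onorm_bound) (auto simp: mult.commute)
  moreover have "bij_betw ?T D UNIV" using inj R by (simp add: bij_betw_def)
  ultimately show ?L using scale by (simp add: resolvent_set_def bounded_clinear_def)
qed

text \<open>The range is closed: if \<open>(z - A) x\<^sub>n\<close> converges, the lower bound makes \<open>x\<^sub>n\<close> a Cauchy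
  sequence, so \<open>A x\<^sub>n\<close> converges as well, and the graph of \<open>A\<close> is closed.\<close>
lemma dense_range_imp_surj:
  fixes A :: "'a::complex_banach \<Rightarrow> 'a"
  assumes A: "closed_operator A D" and "d > 0"
    and below: "\<And>x. x \<in> D \<Longrightarrow> d * norm x \<le> norm (z *\<^sub>C x - A x)"
    and dense: "closure ((\<lambda>x. z *\<^sub>C x - A x) ` D) = UNIV"
  shows "(\<lambda>x. z *\<^sub>C x - A x) ` D = UNIV"
proof (intro set_eqI iffI UNIV_I)
  fix y
  have lin: "linear_operator A D" and cl: "closed {(x, A x) | x. x \<in> D}"
    using A by (auto simp: closed_operator_def)
  note L = linear_operatorD[OF lin]
  have "y \<in> closure ((\<lambda>x. z *\<^sub>C x - A x) ` D)" using dense by simp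
  then obtain v where v: "\<And>n. v n \<in> (\<lambda>x. z *\<^sub>C x - A x) ` D" "v \<longlonglongrightarrow> y"
    unfolding closure_sequential by blast
  then have "\<forall>n. \<exists>x. x \<in> D \<and> v n = z *\<^sub>C x - A x" by blast
  then obtain x where x: "\<And>n. x n \<in> D" "\<And>n. v n = z *\<^sub>C x n - A (x n)" by metis
  have lip: "dist (x m) (x n) \<le> dist (v m) (v n) / d" for m n
  proof -
    have "d * norm (x m - x n) \<le> norm (z *\<^sub>C (x m - x n) - A (x m - x n))"
      using x by (intro below L)
    also have "z *\<^sub>C (x m - x n) - A (x m - x n) = v m - v n"
      using x by (simp add: L complex_vector.scale_right_diff_distrib)
    finally show ?thesis using \<open>d > 0\<close> by (simp add: dist_norm field_simps)
  qed
  have "Cauchy x"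
  proof (rule metric_CauchyI)
    fix e :: real assume "e > 0"
    then obtain M where M: "\<And>m n. m \<ge> M \<Longrightarrow> n \<ge> M \<Longrightarrow> dist (v m) (v n) < e * d"
      using metric_CauchyD[OF LIMSEQ_imp_Cauchy[OF v(2)], of "e * d"] \<open>d > 0\<close> by auto
    have "dist (x m) (x n) < e" if "m \<ge> M" "n \<ge> M" for m n
      using lip[of m n] M[OF that] \<open>d > 0\<close> by (smt (verit) pos_divide_less_eq)
    then show "\<exists>M. \<forall>m\<ge>M. \<forall>n\<ge>M. dist (x m) (x n) < e" by blast
  qed
  then obtain l where l: "x \<longlonglongrightarrow> l" using Cauchy_convergent convergent_def by blast
  have "(\<lambda>n. z *\<^sub>C x n - v n) \<longlonglongrightarrow> z *\<^sub>C l - y"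
    using bounded_linear.tendsto[OF bounded_linear_scaleC l] v(2) by (intro tendsto_diff)
  moreover have "(\<lambda>n. z *\<^sub>C x n - v n) = (\<lambda>n. A (x n))" using x by auto
  ultimately have lim: "(\<lambda>n. (x n, A (x n))) \<longlonglongrightarrow> (l, z *\<^sub>C l - y)"
    using l by (simp add: tendsto_Pair)
  have "(l, z *\<^sub>C l - y) \<in> {(x, A x) | x. x \<in> D}"
    by (rule closed_sequentially[OF cl _ lim]) (use x(1) in blast)
  then have "l \<in> D" "A l = z *\<^sub>C l - y" by auto
  then show "y \<in> (\<lambda>x. z *\<^sub>C x - A x) ` D" by (intro image_eqI[of _ _ l]) auto
qed

text \<open>With \<open>R\<close> the right inverse of \<open>z - A\<close>, a solution of \<open>w x - A x = y\<close> is a fixed point of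
  \<open>x \<mapsto> R (y + (z - w) x)\<close>, a contraction with constant \<open>cmod (z - w) / d\<close>.\<close>
lemma surj_perturbation:
  fixes A :: "'a::complex_banach \<Rightarrow> 'a"
  assumes lin: "linear_operator A D"
    and below: "\<And>x. x \<in> D \<Longrightarrow> d * norm x \<le> norm (z *\<^sub>C x - A x)"
    and surj: "(\<lambda>x. z *\<^sub>C x - A x) ` D = UNIV"
    and near: "cmod (z - w) < d"
  shows "(\<lambda>x. w *\<^sub>C x - A x) ` D = UNIV"
proof (intro set_eqI iffI UNIV_I)
  fix y
  note L = linear_operatorD[OF lin]
  have "d > 0" using near norm_ge_zero[of "z - w"] by linarith
  define R where "R = resolvent A D z"
  have inD: "R u \<in> D" and TR: "z *\<^sub>C R u - A (R u) = u" for u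
    using surj inv_into_into[of u "\<lambda>x. z *\<^sub>C x - A x" D] f_inv_into_f[of u "\<lambda>x. z *\<^sub>C x - A x" D]
    by (auto simp: resolvent_def R_def)
  define F where "F x = R (y + (z - w) *\<^sub>C x)" for x
  have "dist (F u) (F v) \<le> cmod (z - w) / d * dist u v" for u v
  proof -
    have D: "F u \<in> D" "F v \<in> D" by (auto simp: F_def inD)
    have "d * norm (F u - F v) \<le> norm (z *\<^sub>C (F u - F v) - A (F u - F v))"
      using D by (intro below L)
    also have "z *\<^sub>C (F u - F v) - A (F u - F v)
        = (z *\<^sub>C F u - A (F u)) - (z *\<^sub>C F v - A (F v))"
      using D by (simp add: L complex_vector.scale_right_diff_distrib)
    also have "\<dots> = (z - w) *\<^sub>C (u - v)"
      unfolding F_def TR by (simp add: complex_vector.scale_right_diff_distrib)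
    also have "norm \<dots> = cmod (z - w) * dist u v" by (simp add: norm_scaleC dist_norm)
    finally show ?thesis using \<open>d > 0\<close> by (simp add: dist_norm field_simps)
  qed
  moreover have "0 \<le> cmod (z - w) / d" "cmod (z - w) / d < 1" using near \<open>d > 0\<close> by auto
  ultimately obtain x where x: "F x = x" using banach_fix_type[of "cmod (z - w) / d" F] by blast
  have "z *\<^sub>C x - A x = y + (z - w) *\<^sub>C x" using TR[of "y + (z - w) *\<^sub>C x"] x by (simp add: F_def)
  then have "y = w *\<^sub>C x - A x" by (simp add: complex_vector.scale_left_diff_distrib algebra_simps)
  moreover have "x \<in> D" using inD[of "y + (z - w) *\<^sub>C x"] x by (simp add: F_def)
  ultimately show "y \<in> (\<lambda>x. w *\<^sub>C x - A x) ` D" by blast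
qed

text \<open>The radius in \<open>surj_perturbation\<close> is the distance to the boundary line. It is therefore bounded
  away from zero near every point of the half plane, so the set of points with surjectivity and
  its complement in the half plane are both open.\<close>
lemma surj_on_half_plane:
  fixes A :: "'a::complex_banach \<Rightarrow> 'a"
  assumes lin: "linear_operator A D"
    and below: "\<And>z x. z \<in> half_plane \<theta> \<omega> \<Longrightarrow> x \<in> D \<Longrightarrow>
      (inner (cis \<theta>) z - \<omega>) * norm x \<le> norm (z *\<^sub>C x - A x)"
    and z: "z \<in> half_plane \<theta> \<omega>" "(\<lambda>x. z *\<^sub>C x - A x) ` D = UNIV"
    and w: "w \<in> half_plane \<theta> \<omega>"
  shows "(\<lambda>x. w *\<^sub>C x - A x) ` D = UNIV"
proof -
  let ?H = "half_plane \<theta> \<omega>" and ?d = "\<lambda>z. inner (cis \<theta>) z - \<omega>"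
  define S where "S = {v \<in> ?H. (\<lambda>x. v *\<^sub>C x - A x) ` D = UNIV}"
  have d: "?d v > 0" if "v \<in> ?H" for v using that by (simp add: half_plane_eq)
  have d_lip: "?d v - cmod (v - u) \<le> ?d u" for u v
    using norm_cauchy_schwarz[of "cis \<theta>" "v - u"] by (simp add: inner_diff_right)
  have step: "u \<in> S" if "v \<in> S" "u \<in> ?H" "cmod (v - u) < ?d v" for u v
    using surj_perturbation[OF lin below, of v u] that by (simp add: S_def)
  have "open S"
    unfolding open_dist
  proof (intro ballI exI conjI allI impI)
    fix v assume v: "v \<in> S"
    then show "?d v > 0" using d by (simp add: S_def)
    fix u assume "dist u v < ?d v"
    then have lt: "cmod (v - u) < ?d v" by (simp add: dist_norm norm_minus_commute)
    then have "u \<in> ?H" using d_lip[of v u] by (simp add: half_plane_eq)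
    then show "u \<in> S" using step[OF v] lt by blast
  qed
  moreover have "open (?H - S)"
    unfolding open_dist
  proof (intro ballI exI conjI allI impI)
    fix v assume v: "v \<in> ?H - S"
    then show "?d v / 2 > 0" using d[of v] by simp
    fix u assume "dist u v < ?d v / 2"
    then have lt: "cmod (v - u) < ?d v / 2" by (simp add: dist_norm norm_minus_commute)
    then have du: "?d v / 2 < ?d u" using d_lip[of v u] by simp
    then have "u \<in> ?H" using d[of v] v by (simp add: half_plane_eq)
    moreover have "u \<notin> S"
      using step[of u v] v lt du by (auto simp: norm_minus_commute)
    ultimately show "u \<in> ?H - S" by blast
  qed
  moreover have "connected ?H"
    unfolding half_plane_eq by (intro convex_connected convex_halfspace_gt)
  ultimately have "S = {} \<or> ?H - S = {}"
    using connectedD[of ?H S "?H - S"] by (auto simp: S_def)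
  moreover have "z \<in> S" using z by (simp add: S_def)
  ultimately show ?thesis using w by (auto simp: S_def)
qed

section \<open>Numerical range and resolvent bounds\<close>

definition numerical_range :: "('a::complex_normed_vector \<Rightarrow> 'a) \<Rightarrow> 'a set \<Rightarrow> complex set" where
  "numerical_range A D = {j (A x) | x j. x \<in> D \<and> norm x = 1 \<and> j \<in> duality_set x}"

lemma duality_setD:
  assumes "j \<in> duality_set x" "norm x = 1"
  shows "j x = 1" "cmod (j y) \<le> norm y" "j (c *\<^sub>C y) = c * j y" "j (u - v) = j u - j v"
proof -
  have bc: "bounded_clinear j" and "j x = 1" and "(onorm j)\<^sup>2 = 1"
    using assms by (auto simp: duality_set_def)
  have bl: "bounded_linear j" using bc by (simp add: bounded_clinear_def)
  have "onorm j = 1"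
    using \<open>(onorm j)\<^sup>2 = 1\<close> onorm_pos_le[OF bl] by (simp add: power2_eq_1_iff)
  then show "cmod (j y) \<le> norm y" using cmod_le_onorm[OF bc, of y] by simp
  show "j x = 1" by fact
  show "j (c *\<^sub>C y) = c * j y" using bc by (simp add: bounded_clinear_def)
  show "j (u - v) = j u - j v" by (rule linear_diff[OF bounded_linear.linear[OF bl]])
qed

text \<open>For \<open>norm u = 1\<close> and \<open>j\<close> in the duality set of \<open>u\<close>, the number \<open>j (z u - A u) = z - j (A u)\<close>
  is the difference of \<open>z\<close> and a point outside the half plane.\<close>
lemma bounded_below_off_numerical_range:
  fixes A :: "'a::complex_normed_vector \<Rightarrow> 'a"
  assumes lin: "linear_operator A D" and W: "numerical_range A D \<inter> half_plane \<theta> \<omega> = {}"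
    and x: "x \<in> D"
  shows "(inner (cis \<theta>) z - \<omega>) * norm x \<le> norm (z *\<^sub>C x - A x)"
proof (cases "x = 0")
  case False
  note L = linear_operatorD[OF lin]
  define u where "u = complex_of_real (1 / norm x) *\<^sub>C x"
  have u: "u \<in> D" "norm u = 1"
    using x False by (auto simp: u_def L norm_scaleC norm_divide)
  obtain j where j: "j \<in> duality_set u" using duality_set_nonempty[OF u(2)] by blast
  note J = duality_setD[OF j u(2)]
  have "j (A u) \<in> numerical_range A D" using u j by (auto simp: numerical_range_def)
  then have "inner (cis \<theta>) (j (A u)) \<le> \<omega>" using W by (force simp: half_plane_eq)
  then have "inner (cis \<theta>) z - \<omega> \<le> inner (cis \<theta>) (z - j (A u))" by (simp add: inner_diff_right)
  also have "\<dots> \<le> cmod (z - j (A u))"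
    using norm_cauchy_schwarz[of "cis \<theta>" "z - j (A u)"] by simp
  also have "z - j (A u) = j (z *\<^sub>C u - A u)" by (simp add: J)
  also have "cmod \<dots> \<le> norm (z *\<^sub>C u - A u)" by (rule J)
  also have "z *\<^sub>C u - A u = complex_of_real (1 / norm x) *\<^sub>C (z *\<^sub>C x - A x)"
    using x by (simp add: u_def L complex_vector.scale_right_diff_distrib scaleC_scaleC mult.commute)
  also have "norm \<dots> = norm (z *\<^sub>C x - A x) / norm x" by (simp add: norm_scaleC norm_divide)
  finally show ?thesis using False by (simp add: field_simps)
qed (simp)

text \<open>Let \<open>S = t (t - B)\<^sup>-\<^sup>1\<close>, a contraction by \<open>below\<close>. From \<open>norm x = j x = 1\<close> one gets
  \<open>Re (j (S x - x)) \<le> 0\<close>, and \<open>t (S x - x) = S (B x)\<close>, so \<open>Re (j (S (B x))) \<le> 0\<close>. As \<open>t\<close> grows,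
  \<open>S\<close> tends to the identity: on \<open>D\<close> since \<open>S u - u = (t - B)\<^sup>-\<^sup>1 (B u)\<close> has norm at most
  \<open>norm (B u) / t\<close>, and then everywhere by density. The limit is the claim, for every \<open>j\<close>
  in the duality set.\<close>
lemma Lumer_Phillips_dissipative:
  fixes B :: "'a::complex_normed_vector \<Rightarrow> 'a"
  assumes lin: "linear_operator B D" and dense: "densely_defined D"
    and surj: "\<And>t y. t > 0 \<Longrightarrow> \<exists>x\<in>D. t *\<^sub>R x - B x = y"
    and below: "\<And>t x. t > 0 \<Longrightarrow> x \<in> D \<Longrightarrow> t * norm x \<le> norm (t *\<^sub>R x - B x)"
    and x: "x \<in> D" "norm x = 1" and j: "j \<in> duality_set x"
  shows "Re (j (B x)) \<le> 0"
proof -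
  note L = linear_operatorD[OF lin] and J = duality_setD[OF j x(2)]
  have LR: "t *\<^sub>R u \<in> D" "B (t *\<^sub>R u) = t *\<^sub>R B u" if "u \<in> D" for t u
    using that by (simp_all add: scaleR_scaleC L)
  have JR: "j (t *\<^sub>R u) = t * j u" for t u by (simp add: scaleR_scaleC J)
  have Re_j: "Re (j u) \<le> norm u" for u using J(2) complex_Re_le_cmod order_trans by blast
  \<comment> \<open>\<open>B\<close> commutes with \<open>(t - B)\<^sup>-\<^sup>1\<close> on \<open>D\<close>\<close>
  have commute: "B s \<in> D" "t *\<^sub>R B s - B (B s) = B u"
    if "s \<in> D" "u \<in> D" "t *\<^sub>R s - B s = u" for t s u
  proof -
    have Bs: "B s = t *\<^sub>R s - u" using that(3) by (simp add: algebra_simps)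
    show "B s \<in> D" unfolding Bs using that by (intro L LR)
    have "B (B s) = t *\<^sub>R B s - B u"
      using that by (subst arg_cong[OF Bs, of B]) (simp add: L(7) LR)
    then show "t *\<^sub>R B s - B (B s) = B u" by simp
  qed
  have approx: "Re (j (B x)) \<le> 2 * norm (B x - u) + norm (B u) / t"
    if t: "t > 0" and u: "u \<in> D" for t u
  proof -
    \<comment> \<open>\<open>t *\<^sub>R B s\<close> is \<open>S (B x)\<close> and \<open>t *\<^sub>R v\<close> is \<open>S u\<close>; the two distances \<open>norm (B x - u)\<close> below
      come from \<open>u\<close> approximating \<open>B x\<close> before and after \<open>S\<close> is applied.\<close>
    obtain s where s: "s \<in> D" "t *\<^sub>R s - B s = x" using surj[OF t] by blast
    obtain v where v: "v \<in> D" "t *\<^sub>R v - B v = u" using surj[OF t] by blast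
    note Bs = commute[OF s(1) x(1) s(2)] and Bv = commute[OF v(1) u v(2)]
    have "t * norm s \<le> 1" using below[OF t s(1)] s(2) x(2) by simp
    then have "Re (j (t *\<^sub>R s)) \<le> 1" using Re_j[of "t *\<^sub>R s"] t by simp
    moreover have "B s = t *\<^sub>R s - x" using s(2) by (simp add: algebra_simps)
    ultimately have "Re (j (B s)) \<le> 0" using J(1,4) by simp
    then have "Re (j (t *\<^sub>R B s)) \<le> 0" using t by (simp add: JR mult_le_0_iff)
    moreover have "Re (j (B x - t *\<^sub>R B s)) \<le> norm (B x - t *\<^sub>R B s)" by (rule Re_j)
    moreover have "norm (B x - t *\<^sub>R B s) \<le> norm (B x - u) + norm (B v) + t * norm (B s - v)"
    proof -
      have "B x - t *\<^sub>R B s = (B x - u) + (- B v) + t *\<^sub>R (v - B s)"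
        using v(2) by (simp add: algebra_simps)
      also have "norm \<dots> \<le> norm (B x - u) + norm (- B v) + norm (t *\<^sub>R (v - B s))"
        by (intro norm_triangle_le add_mono) auto
      finally show ?thesis using t by (simp add: norm_minus_commute)
    qed
    moreover have "t * norm (B s - v) \<le> norm (B x - u)"
    proof -
      have "t *\<^sub>R (B s - v) - B (B s - v) = (t *\<^sub>R B s - B (B s)) - (t *\<^sub>R v - B v)"
        using Bs(1) v(1) by (simp add: L(7) scaleR_diff_right)
      then have "t *\<^sub>R (B s - v) - B (B s - v) = B x - u" using Bs(2) v(2) by simp
      then show ?thesis using below[OF t L(6)[OF Bs(1) v(1)]] by simp
    qed
    moreover have "norm (B v) \<le> norm (B u) / t"
      using below[OF t Bv(1)] Bv(2) t by (simp add: field_simps)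
    ultimately show ?thesis using J(4) by simp
  qed
  have lim: "Re (j (B x)) \<le> 2 * norm (B x - u)" if u: "u \<in> D" for u
  proof (rule field_le_epsilon)
    fix e :: real assume "e > 0"
    define t where "t = (norm (B u) + 1) / e"
    have pos: "norm (B u) + 1 > 0" by (simp add: add_nonneg_pos)
    then have "t > 0" using \<open>e > 0\<close> by (simp add: t_def)
    have "norm (B u) / t \<le> e" using \<open>e > 0\<close> pos by (simp add: t_def field_simps)
    then show "Re (j (B x)) \<le> 2 * norm (B x - u) + e" using approx[OF \<open>t > 0\<close> u] by simp
  qed
  show ?thesis
  proof (rule field_le_epsilon)
    fix e :: real assume "e > 0"
    have "B x \<in> closure D" using dense by (simp add: densely_defined_def)
    then obtain u where "u \<in> D" "dist u (B x) < e / 2"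
      using \<open>e > 0\<close> unfolding closure_approachable by (meson half_gt_zero)
    then show "Re (j (B x)) \<le> 0 + e" using lim[of u] by (simp add: dist_norm norm_minus_commute)
  qed
qed

lemma numerical_range_off_half_plane:
  fixes A :: "'a::complex_normed_vector \<Rightarrow> 'a"
  assumes lin: "linear_operator A D" and dense: "densely_defined D"
    and surj: "\<And>z. z \<in> half_plane \<theta> \<omega> \<Longrightarrow> (\<lambda>x. z *\<^sub>C x - A x) ` D = UNIV"
    and below: "\<And>z x. z \<in> half_plane \<theta> \<omega> \<Longrightarrow> x \<in> D \<Longrightarrow>
      (inner (cis \<theta>) z - \<omega>) * norm x \<le> norm (z *\<^sub>C x - A x)"
  shows "numerical_range A D \<inter> half_plane \<theta> \<omega> = {}"
proof -
  note L = linear_operatorD[OF lin]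
  define B where "B x = cis (- \<theta>) *\<^sub>C A x - complex_of_real \<omega> *\<^sub>C x" for x
  \<comment> \<open>the ray in the half plane perpendicular to its boundary, at distance \<open>t\<close> from it\<close>
  define \<mu> where "\<mu> t = cis \<theta> * complex_of_real (\<omega> + t)" for t
  have B: "linear_operator B D"
    using lin unfolding linear_operator_def B_def
    by (simp add: scaleC_add_right complex_vector.scale_right_diff_distrib scaleC_scaleC mult.commute)
  have B_eq: "t *\<^sub>R x - B x = cis (- \<theta>) *\<^sub>C (\<mu> t *\<^sub>C x - A x)" for t x
  proof -
    have "cis (- \<theta>) * \<mu> t = complex_of_real \<omega> + complex_of_real t"
      unfolding \<mu>_def mult.assoc[symmetric] cis_mult by simp
    then show ?thesis
      by (simp add: B_def complex_vector.scale_right_diff_distrib scaleC_scaleC scaleR_scaleC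
          scaleC_add_left)
  qed
  have inner_\<mu>: "inner (cis \<theta>) (\<mu> t) = \<omega> + t" for t
  proof -
    have "\<mu> t = (\<omega> + t) *\<^sub>R cis \<theta>"
      by (simp only: \<mu>_def scaleR_conv_of_real mult.commute)
    then show ?thesis by (simp add: dot_square_norm)
  qed
  then have \<mu>_in: "\<mu> t \<in> half_plane \<theta> \<omega>" if "t > 0" for t
    using that by (simp add: half_plane_eq)
  have B_below: "t * norm x \<le> norm (t *\<^sub>R x - B x)" if "t > 0" "x \<in> D" for t x
    using below[OF \<mu>_in[OF that(1)] that(2)] inner_\<mu>[of t] by (simp add: B_eq norm_scaleC)
  have B_surj: "\<exists>x\<in>D. t *\<^sub>R x - B x = y" if "t > 0" for t y
  proof -
    have "cis \<theta> *\<^sub>C y \<in> (\<lambda>x. \<mu> t *\<^sub>C x - A x) ` D" using surj[OF \<mu>_in[OF that]] by simp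
    then obtain x where "x \<in> D" "cis \<theta> *\<^sub>C y = \<mu> t *\<^sub>C x - A x" by blast
    then show ?thesis
      by (intro bexI[of _ x])
        (simp_all add: B_eq scaleC_scaleC cis_mult scaleC_one flip: \<open>cis \<theta> *\<^sub>C y = _\<close>)
  qed
  have "inner (cis \<theta>) (j (A x)) \<le> \<omega>"
    if x: "x \<in> D" "norm x = 1" and j: "j \<in> duality_set x" for x j
  proof -
    note J = duality_setD[OF j x(2)]
    have "j (B x) = cis (- \<theta>) * j (A x) - \<omega>" by (simp add: B_def J)
    moreover have "Re (j (B x)) \<le> 0"
      by (rule Lumer_Phillips_dissipative[OF B dense B_surj B_below x j])
    ultimately show ?thesis by (simp add: inner_complex_def)
  qed
  then show ?thesis by (force simp: numerical_range_def half_plane_eq)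
qed

theorem theorem2p5:
  fixes A :: "'a::complex_banach \<Rightarrow> 'a" and D :: "'a set"
  assumes "closed_operator A D" and "densely_defined D"
  shows "numerical_spectrum A D =
           closure (convex hull {j (A x) | x j. x \<in> D \<and> norm x = 1 \<and> j \<in> duality_set x})
           \<union> residual_spectrum A D"
proof -
  have lin: "linear_operator A D" using assms by (simp add: closed_operator_def)
  let ?T = "\<lambda>z x. z *\<^sub>C x - A x" and ?W = "closure (convex hull (numerical_range A D))"
  \<comment> \<open>the condition on a half plane in the definition of the numerical resolvent set, without
    resolvents\<close>
  have admissible_iff: "half_plane \<theta> \<omega> \<subseteq> resolvent_set A D \<and>
      (\<forall>z\<in>half_plane \<theta> \<omega>. onorm (resolvent A D z) \<le> 1 / infdist z (frontier (half_plane \<theta> \<omega>)))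
    \<longleftrightarrow> (\<forall>z\<in>half_plane \<theta> \<omega>. ?T z ` D = UNIV \<and>
      (\<forall>x\<in>D. (inner (cis \<theta>) z - \<omega>) * norm x \<le> norm (?T z x)))" (is "?adm \<theta> \<omega> \<longleftrightarrow> _") for \<theta> \<omega>
  proof -
    have "z \<in> resolvent_set A D \<and>
        onorm (resolvent A D z) \<le> 1 / infdist z (frontier (half_plane \<theta> \<omega>)) \<longleftrightarrow>
      ?T z ` D = UNIV \<and> (\<forall>x\<in>D. (inner (cis \<theta>) z - \<omega>) * norm x \<le> norm (?T z x))"
      if z: "z \<in> half_plane \<theta> \<omega>" for z
      unfolding infdist_frontier_half_plane[OF z]
      using z by (intro resolvent_set_iff[OF lin]) (simp add: half_plane_eq)
    then show ?thesis by blast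
  qed
  have "z \<in> numerical_resolvent_set A D \<longleftrightarrow> z \<notin> ?W \<union> residual_spectrum A D" for z
  proof
    assume "z \<in> numerical_resolvent_set A D"
    then obtain \<theta> \<omega> where z: "z \<in> half_plane \<theta> \<omega>" and "?adm \<theta> \<omega>"
      unfolding numerical_resolvent_set_def by blast
    then have adm: "?T v ` D = UNIV" "\<And>x. x \<in> D \<Longrightarrow> (inner (cis \<theta>) v - \<omega>) * norm x \<le> norm (?T v x)"
      if "v \<in> half_plane \<theta> \<omega>" for v
      using that admissible_iff by blast+
    have "numerical_range A D \<inter> half_plane \<theta> \<omega> = {}"
      using numerical_range_off_half_plane[OF lin assms(2) adm] by blast
    then have "numerical_range A D \<subseteq> {v. inner (cis \<theta>) v \<le> \<omega>}"
      by (force simp: half_plane_eq)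
    then have "?W \<subseteq> {v. inner (cis \<theta>) v \<le> \<omega>}"
      by (intro closure_minimal hull_minimal closed_halfspace_le convex_halfspace_le)
    then have "z \<notin> ?W" using z by (auto simp: half_plane_eq)
    moreover have "z \<notin> residual_spectrum A D"
      using adm(1)[OF z] by (simp add: residual_spectrum_def)
    ultimately show "z \<notin> ?W \<union> residual_spectrum A D" by blast
  next
    assume z: "z \<notin> ?W \<union> residual_spectrum A D"
    have "convex ?W" "closed ?W" "z \<notin> ?W" using z by (auto intro: convex_closure)
    then obtain \<theta> \<omega> where \<theta>: "0 \<le> \<theta>" "\<theta> < 2 * pi" and zH: "z \<in> half_plane \<theta> \<omega>"
      and "?W \<inter> half_plane \<theta> \<omega> = {}"
      by (rule half_plane_separation)
    then have W: "numerical_range A D \<inter> half_plane \<theta> \<omega> = {}"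
      using closure_subset[of "convex hull (numerical_range A D)"]
        hull_subset[of "numerical_range A D" convex] by blast
    note below = bounded_below_off_numerical_range[OF lin W]
    have "?T z ` D = UNIV"
      using zH z by (intro dense_range_imp_surj[OF assms(1) _ below])
        (auto simp: half_plane_eq residual_spectrum_def)
    then have "?T v ` D = UNIV" if "v \<in> half_plane \<theta> \<omega>" for v
      using surj_on_half_plane[OF lin below zH _ that] by blast
    then have "?adm \<theta> \<omega>" unfolding admissible_iff using below by blast
    then show "z \<in> numerical_resolvent_set A D"
      unfolding numerical_resolvent_set_def using \<theta> zH by blast
  qed
  then show ?thesis
    unfolding numerical_spectrum_def numerical_range_def[symmetric] by blast
qed

end
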